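(* Use the setting of the context. When switching from waiting for $k_\tau$ workers to waiting for $k_{\tau+1}>k_\tau$ workers, define $\beta_{\min}=\frac1s\left\lceil\frac{k_\tau s}{k_{\tau+1}}\right\rceil$. To obtain the optimal $\beta_{\tau+1}$, solve the optimization problem $$\beta_{\text{opt}}=\operatorname*{arg\,max}_{\beta_{\min}\le\beta\le1}\frac{|\partial E(k_{\tau+1},\beta,j)/\partial j|}{\mu_{k_{\tau+1}:n}(\beta)}=:\operatorname*{arg\,max}_{\beta_{\min}\le\beta\le1}O,$$ where, to calculate $\partial E(k_{\tau+1},\beta,j)/\partial j$ from the SGD error bound of the context, $j$ is replaced by $(t_\tau-t_{\tau-1})/\mu_\tau$ and $F(\mathbf w_0)$ by $F(\mathbf w_{t_{\tau-1}})$ to account for the state of convergence. The parameter $\beta_{\tau+1}$ is then obtained by rounding, i.e. $\beta_{\tau+1}=\lceil s\beta_{\text{opt}}\rceil/s$. If the objective $O$ is concave, the solution can be obtained by solving the unconstrained optimization and subsequently clipping $\lceil s\beta_{\text{opt}}\rceil/s$ to $\beta_{\tau+1}\in[\beta_{\min},1]$. Here $\beta_{\text{opt}}$ is obtained by solving $$\frac{\partial\mu_{k_{\tau+1}:n}(\beta)}{\partial\beta}\,\beta\,(\beta k_{\tau+1}-\phi_\tau)+\phi_\tau\big(\mu_\tau-\mu_{k_{\tau+1}:n}(\beta)\big)=0$$ for $\beta$ and choosing the value that maximizes $O$.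
   Context: A main node runs SGD with fixed learning rate $\eta$ using $n$ workers, each holding $s$ samples. The iterations are grouped into stages. In stage $\tau$ the main node waits in each iteration for the $k_\tau$ fastest of the $n$ workers, and each worker uses a random batch of $\beta_\tau s$ of its samples, where $\beta_\tau\in(0,1]$ is a multiple of $1/s$. Put $\phi_\tau=k_\tau\beta_\tau$; the scheme is designed so that $\phi_{\tau+1}>\phi_\tau$. Let $\mu_{k:n}(\beta)$ be the expectation of the $k$-th order statistic of the $n$ i.i.d. worker response times at batch scale $\beta$ (the expected duration of an iteration), and put $\mu_\tau=\mu_{k_\tau:n}(\beta_\tau)$. The constants $L$, $c$, $\sigma^2_{\text{grad}}$ are respectively the Lipschitz constant, the convexity parameter, and an upper bound on the variance of the gradient of the loss function; $\alpha=-\log(1-\eta c)>0$. Error bound. Let $F$ be the loss, $F^\star$ the optimal loss and $\mathbf w_0$ the initial model. The expected gap to the optimal loss after $j$ iterations with parameters $k,\beta$ is bounded by (and in the analysis taken equal to) $$E(k,\beta,j)=\frac{\eta L\sigma^2_{\text{grad}}}{2cks\beta}+(1-\eta c)^j\Big(F(\mathbf w_0)-F^\star-\frac{\eta L\sigma^2_{\text{grad}}}{2cks\beta}\Big).$$ Switching time. Stage $\tau$ starts at time $t_{\tau-1}$ with model $\mathbf w_{t_{\tau-1}}$ and error $e(t_{\tau-1})=F(\mathbf w_{t_{\tau-1}})-F^\star$. With $\phi_{\tau+1}=k_{\tau+1}\beta$ and $\mu_{\tau+1}=\mu_{k_{\tau+1}:n}(\beta)$, the time $t_\tau$ of switching to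 stage $\tau+1$ is $$t_\tau=t_{\tau-1}+\frac{\mu_\tau}{\alpha}\log\frac{(\mu_{\tau+1}-\mu_\tau)\,\phi_{\tau+1}\,(2c\phi_\tau s\,e(t_{\tau-1})-\eta L\sigma^2_{\text{grad}})}{\mu_\tau\,\eta L\sigma^2_{\text{grad}}\,(\phi_{\tau+1}-\phi_\tau)}.$$ Meaning of the replacement in the objective. The rate $|\partial E(k_{\tau+1},\beta,j)/\partial j|$ is the one right after switching, with the error at the switching time as reference error; that error is obtained from the bound with the parameters of stage $\tau$, with $j$ replaced by the expected number $(t_\tau-t_{\tau-1})/\mu_\tau$ of iterations run in stage $\tau$ and $F(\mathbf w_0)$ replaced by $F(\mathbf w_{t_{\tau-1}})$. *)

theory Defs
  imports "HOL-Probability.Probability"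
begin

text \<open>
  Data of one switching decision, from the current stage (waiting for the \<open>k_cur\<close> fastest of
  \<open>n_workers\<close> workers, at batch scale \<open>beta_cur\<close>) to the next one (waiting for \<open>k_next\<close>).
  \<open>resp_time \<beta> i\<close> is the response time of worker \<open>i < n_workers\<close> at batch scale \<open>\<beta>\<close>.
  Since the batch scale is optimised as a real variable, and may leave \<open>(0,1]\<close> in the
  unconstrained problem, the response-time model is given on an open set \<open>scales\<close> of positive
  reals containing \<open>(0,1]\<close>; larger scales have no operational meaning.
  The fields \<open>t_start\<close> and \<open>w_start\<close> are the time and the model at the start of the current stage.
\<close>

record ('a, 'w) sgd_stage =
  M_resp :: "'a measure"
  scales :: "real set"
  resp_time :: "real \<Rightarrow> nat \<Rightarrow> 'a \<Rightarrow> real"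
  n_workers :: nat
  n_samples :: nat
  lrate :: real
  lip :: real
  cvx :: real
  grad_var :: real
  loss :: "'w \<Rightarrow> real"
  t_start :: real
  w_start :: 'w
  k_cur :: nat
  beta_cur :: real
  k_next :: nat

definition order_stat :: "nat \<Rightarrow> nat \<Rightarrow> (nat \<Rightarrow> real) \<Rightarrow> real" where
  "order_stat n k x = sort (map x [0..<n]) ! (k - 1)"

definition mean_time :: "('a, 'w) sgd_stage \<Rightarrow> nat \<Rightarrow> real \<Rightarrow> real" where
  "mean_time P k \<beta> =
     (\<integral>\<omega>. order_stat (n_workers P) k (\<lambda>i. resp_time P \<beta> i \<omega>) \<partial>(M_resp P))"

definition alpha :: "('a, 'w) sgd_stage \<Rightarrow> real" where
  "alpha P = - ln (1 - lrate P * cvx P)"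

definition opt_loss :: "('a, 'w) sgd_stage \<Rightarrow> real" where
  "opt_loss P = (INF w. loss P w)"

text \<open>
  The error bound as a function of the reference loss \<open>F0\<close> (the loss at the initial model) and of
  a real number \<open>j\<close> of iterations, since it is differentiated in \<open>j\<close>.
\<close>

definition error_bound :: "('a, 'w) sgd_stage \<Rightarrow> real \<Rightarrow> nat \<Rightarrow> real \<Rightarrow> real \<Rightarrow> real" where
  "error_bound P F0 k \<beta> j =
     lrate P * lip P * grad_var P / (2 * cvx P * real k * real (n_samples P) * \<beta>)
     + (1 - lrate P * cvx P) powr j
       * (F0 - opt_loss P
          - lrate P * lip P * grad_var P / (2 * cvx P * real k * real (n_samples P) * \<beta>))"

definition phi_cur :: "('a, 'w) sgd_stage \<Rightarrow> real" where
  "phi_cur P = real (k_cur P) * beta_cur P"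

definition phi_next :: "('a, 'w) sgd_stage \<Rightarrow> real \<Rightarrow> real" where
  "phi_next P \<beta> = real (k_next P) * \<beta>"

definition mu_cur :: "('a, 'w) sgd_stage \<Rightarrow> real" where
  "mu_cur P = mean_time P (k_cur P) (beta_cur P)"

definition mu_next :: "('a, 'w) sgd_stage \<Rightarrow> real \<Rightarrow> real" where
  "mu_next P \<beta> = mean_time P (k_next P) \<beta>"

definition err_start :: "('a, 'w) sgd_stage \<Rightarrow> real" where
  "err_start P = loss P (w_start P) - opt_loss P"

definition t_switch :: "('a, 'w) sgd_stage \<Rightarrow> real \<Rightarrow> real" where
  "t_switch P \<beta> = t_start P + mu_cur P / alpha P *
     ln ((mu_next P \<beta> - mu_cur P) * phi_next P \<beta>
         * (2 * cvx P * phi_cur P * real (n_samples P) * err_start P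
            - lrate P * lip P * grad_var P)
       / (mu_cur P * (lrate P * lip P * grad_var P) * (phi_next P \<beta> - phi_cur P)))"

text \<open>
  The error at the switching time is the current stage's bound, started from the loss at
  \<open>w_start\<close>, after the expected number of iterations of that stage.
\<close>

definition err_switch :: "('a, 'w) sgd_stage \<Rightarrow> real \<Rightarrow> real" where
  "err_switch P \<beta> =
     error_bound P (loss P (w_start P)) (k_cur P) (beta_cur P)
       ((t_switch P \<beta> - t_start P) / mu_cur P)"

text \<open>
  The decay rate right after switching: the next stage's bound is restarted at \<open>j = 0\<close> with the
  error at the switching time as reference error.
\<close>

definition objective :: "('a, 'w) sgd_stage \<Rightarrow> real \<Rightarrow> real" where
  "objective P \<beta> =
     \<bar>deriv (\<lambda>j. error_bound P (opt_loss P + err_switch P \<beta>) (k_next P) \<beta> j) 0\<bar> / mu_next P \<beta>"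

text \<open>
  The scales at which the switching time, hence the objective, is defined: the scheme requires
  \<open>phi_cur P < phi_next P \<beta>\<close>, and the logarithm in the switching time then requires
  \<open>mu_cur P < mu_next P \<beta>\<close>.  Elsewhere \<open>objective\<close> only has the values of totalised \<open>ln\<close> and
  division.  This matters even at \<open>\<beta> = beta_min P\<close>, where \<open>phi_next P \<beta> = phi_cur P\<close> can happen.
\<close>

definition obj_domain :: "('a, 'w) sgd_stage \<Rightarrow> real set" where
  "obj_domain P = {\<beta> \<in> scales P. phi_cur P < phi_next P \<beta> \<and> mu_cur P < mu_next P \<beta>}"

definition beta_min :: "('a, 'w) sgd_stage \<Rightarrow> real" where
  "beta_min P =
     of_int \<lceil>real (k_cur P) * real (n_samples P) / real (k_next P)\<rceil> / real (n_samples P)"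

definition argmax_on :: "('b \<Rightarrow> real) \<Rightarrow> 'b set \<Rightarrow> 'b set" where
  "argmax_on f S = {x. is_arg_max f (\<lambda>y. y \<in> S) x}"

definition feasible_scales :: "('a, 'w) sgd_stage \<Rightarrow> real set" where
  "feasible_scales P = {beta_min P..1} \<inter> obj_domain P"

definition round_scale :: "('a, 'w) sgd_stage \<Rightarrow> real \<Rightarrow> real" where
  "round_scale P \<beta> = of_int \<lceil>real (n_samples P) * \<beta>\<rceil> / real (n_samples P)"

text \<open>A set, since the maximiser of the constrained problem need not be unique.\<close>

definition next_scales :: "('a, 'w) sgd_stage \<Rightarrow> real set" where
  "next_scales P = round_scale P ` argmax_on (objective P) (feasible_scales P)"

definition stationary_scales :: "('a, 'w) sgd_stage \<Rightarrow> real set" where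
  "stationary_scales P =
     {\<beta> \<in> obj_domain P.
        deriv (mu_next P) \<beta> * \<beta> * (\<beta> * real (k_next P) - phi_cur P)
        + phi_cur P * (mu_cur P - mu_next P \<beta>) = 0}"

definition response_model :: "('a, 'w) sgd_stage \<Rightarrow> bool" where
  "response_model P \<longleftrightarrow>
     prob_space (M_resp P) \<and>
     open (scales P) \<and> {0<..1} \<subseteq> scales P \<and> scales P \<subseteq> {0<..} \<and>
     (\<forall>\<beta>\<in>scales P.
        prob_space.indep_vars (M_resp P) (\<lambda>_. borel) (resp_time P \<beta>) {..<n_workers P} \<and>
        (\<forall>i<n_workers P.
           distr (M_resp P) borel (resp_time P \<beta> i) = distr (M_resp P) borel (resp_time P \<beta> 0) \<and>
           (AE \<omega> in M_resp P. 0 < resp_time P \<beta> i \<omega>)) \<and>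
        (\<forall>k\<in>{k_cur P, k_next P}.
           integrable (M_resp P)
             (\<lambda>\<omega>. order_stat (n_workers P) k (\<lambda>i. resp_time P \<beta> i \<omega>))))"

text \<open>
  The last condition says that the error at the start of the stage is above the error floor of
  the stage; otherwise the logarithm in the switching time is undefined.
\<close>

definition sgd_setting :: "('a, 'w) sgd_stage \<Rightarrow> bool" where
  "sgd_setting P \<longleftrightarrow>
     1 \<le> k_cur P \<and> k_cur P < k_next P \<and> k_next P \<le> n_workers P \<and>
     1 \<le> n_samples P \<and>
     (\<exists>m::nat. 1 \<le> m \<and> m \<le> n_samples P \<and> beta_cur P = real m / real (n_samples P)) \<and>
     0 < lrate P \<and> 0 < lip P \<and> 0 < cvx P \<and> 0 < grad_var P \<and>
     lrate P * cvx P < 1 \<and>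
     bdd_below (range (loss P)) \<and>
     lrate P * lip P * grad_var P < 2 * cvx P * phi_cur P * real (n_samples P) * err_start P"

end

theory Submission
  imports Defs
begin

text \<open>
  At the switching time the logarithm cancels the exponential decay, so on the domain the objective is
  a positive constant times \<open>(\<beta> k - \<phi>) / (\<beta> (\<mu>(\<beta>) - \<mu>))\<close>; the numerator of its derivative is, up to
  sign, the left-hand side of the stationarity equation.  The domain is open because the mean response
  time is continuous there, so for a concave objective maximisers and stationary points coincide.
  Maximising a concave function over an interval amounts to clipping its maximisers, and
  clipping commutes with rounding because rounding is monotone and fixes both \<open>\<beta>\<^sub>m\<^sub>i\<^sub>n\<close> and \<open>1\<close>.
\<close>

section \<open>Concave functions on the real line: clipping and stationary points\<close>

lemma mem_argmax_on:
  fixes f :: "'b \<Rightarrow> real"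
  shows "x \<in> argmax_on f S \<longleftrightarrow> x \<in> S \<and> (\<forall>y\<in>S. f y \<le> f x)"
  by (auto simp: argmax_on_def is_arg_max_linorder)

text \<open>The graph lies above the chord from \<open>z\<close> to the better point
  \<open>x\<close>, and that chord never drops below \<open>f z\<close>. For \<open>c\<close>
  different from \<open>z\<close> the weight of \<open>x\<close> is positive, so a strict gap is
  inherited. Below, \<open>c\<close> is a clipped maximiser.\<close>

lemma concave_on_closed_segment_ge:
  fixes f :: "real \<Rightarrow> real"
  assumes "concave_on D f" "x \<in> D" "z \<in> D" "f z \<le> f x" "c \<in> closed_segment z x"
  shows "c \<in> D" "f z \<le> f c"
    and "f z < f x \<Longrightarrow> c \<noteq> z \<Longrightarrow> f z < f c"
proof -
  obtain u where u: "0 \<le> u" "u \<le> 1" and c: "c = (1 - u) * z + u * x"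
    using assms(5) by (auto simp: in_segment)
  show "c \<in> D"
    using closed_segment_subset[OF assms(3,2) concave_on_imp_convex[OF assms(1)]] assms(5) by blast
  have conc: "f c \<ge> (1 - u) * f z + u * f x"
    using concave_onD[OF assms(1) u assms(3,2)] c by simp
  have eq: "(1 - u) * f z + u * f x = f z + u * (f x - f z)"
    by (simp add: algebra_simps)
  show "f z \<le> f c"
    using conc eq u assms(4) by (smt (verit) mult_nonneg_nonneg)
  show "f z < f c" if "f z < f x" "c \<noteq> z"
  proof -
    have "u \<noteq> 0"
      using that(2) c by auto
    then have "0 < u * (f x - f z)"
      using u that(1) by simp
    then show ?thesis
      using conc eq by linarith
  qed
qed

text \<open>For every \<open>z\<close> in the interval, the clip of \<open>x\<close> lies between
  \<open>z\<close> and \<open>x\<close>, so clipping a global maximiser \<open>x\<close> yields a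
  point at least as good as \<open>z\<close>.\<close>

lemma argmax_on_Icc_Int_concave:
  fixes f :: "real \<Rightarrow> real"
  assumes conc: "concave_on D f" and "a \<le> b"
    and ne: "{a..b} \<inter> D \<noteq> {}" and max_ne: "argmax_on f D \<noteq> {}"
  shows "argmax_on f ({a..b} \<inter> D) = (\<lambda>x. max a (min b x)) ` argmax_on f D"
proof -
  let ?clip = "\<lambda>x. max a (min b x)"
  have seg: "?clip x \<in> closed_segment z x" if "z \<in> {a..b}" for x z
    using that by (auto simp: closed_segment_eq_real_ivl max_def min_def)
  have in_ab: "?clip x \<in> {a..b}" for x
    using \<open>a \<le> b\<close> by auto
  show ?thesis
  proof (intro equalityI subsetI)
    fix y assume y: "y \<in> argmax_on f ({a..b} \<inter> D)"
    then have yD: "y \<in> {a..b}" "y \<in> D" and ymax: "\<And>z. z \<in> {a..b} \<Longrightarrow> z \<in> D \<Longrightarrow> f z \<le> f y"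
      by (auto simp: mem_argmax_on)
    obtain x where x: "x \<in> argmax_on f D"
      using max_ne by blast
    then have xD: "x \<in> D" and xmax: "\<And>z. z \<in> D \<Longrightarrow> f z \<le> f x"
      by (auto simp: mem_argmax_on)
    show "y \<in> ?clip ` argmax_on f D"
    proof (cases "f y = f x")
      case True
      then have "y \<in> argmax_on f D"
        using yD xmax by (simp add: mem_argmax_on)
      moreover have "?clip y = y"
        using yD by auto
      ultimately show ?thesis
        by force
    next
      case False
      then have less: "f y < f x"
        using xmax[OF yD(2)] by simp
      note c = concave_on_closed_segment_ge[OF conc xD yD(2) xmax[OF yD(2)] seg[OF yD(1)]]
      \<comment> \<open>Otherwise the clip would be a feasible point strictly better than
        \<open>y\<close>.\<close>
      have "?clip x = y"
        using c(3)[OF less] ymax[OF in_ab c(1)] by (meson not_less)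
      then show ?thesis
        using x by blast
    qed
  next
    fix y assume "y \<in> ?clip ` argmax_on f D"
    then obtain x where x: "x \<in> D" "\<And>z. z \<in> D \<Longrightarrow> f z \<le> f x" and y: "y = ?clip x"
      by (auto simp: mem_argmax_on)
    have "y \<in> D \<and> f z \<le> f y" if "z \<in> {a..b} \<inter> D" for z
      using concave_on_closed_segment_ge[OF conc x(1) _ x(2) seg] that y by blast
    \<comment> \<open>A point \<open>z\<close> from \<open>ne\<close> is what places the clip in
      \<open>D\<close>, by convexity.\<close>
    then show "y \<in> argmax_on f ({a..b} \<inter> D)"
      using ne in_ab y by (force simp only: mem_argmax_on Int_iff)
  qed
qed

text \<open>Forward, a maximiser on an open set is a local maximum. Backward, the convex function
  \<open>- f\<close> lies above its tangent, which is horizontal at \<open>x\<close>.\<close>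

lemma concave_on_argmax_iff_DERIV_zero:
  fixes f :: "real \<Rightarrow> real"
  assumes "concave_on D f" "open D" "x \<in> D" "(f has_real_derivative f') (at x)"
  shows "x \<in> argmax_on f D \<longleftrightarrow> f' = 0"
proof
  assume "x \<in> argmax_on f D"
  then have max: "\<And>y. y \<in> D \<Longrightarrow> f y \<le> f x"
    by (simp add: mem_argmax_on)
  obtain d where "d > 0" "ball x d \<subseteq> D"
    using assms(2,3) openE by blast
  then have "\<forall>y. \<bar>x - y\<bar> < d \<longrightarrow> f y \<le> f x"
    using max by (auto simp: subset_iff dist_real_def)
  then show "f' = 0"
    using DERIV_local_max[OF assms(4) \<open>d > 0\<close>] by simp
next
  assume "f' = 0"
  have conv: "convex_on D (\<lambda>x. - f x)"
    using assms(1) by (simp add: concave_on_def)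
  have "((\<lambda>x. - f x) has_real_derivative 0) (at x within D)"
    using DERIV_minus[OF assms(4)] \<open>f' = 0\<close> by (simp add: has_field_derivative_at_within)
  moreover have "connected D"
    using conv by (simp add: convex_on_def convex_connected)
  moreover have "x \<in> interior D"
    using assms(2,3) by (simp add: interior_open)
  ultimately have "- f y - - f x \<ge> 0 * (y - x)" if "y \<in> D" for y
    using convex_on_imp_above_tangent[OF conv] that by blast
  then show "x \<in> argmax_on f D"
    using assms(3) by (auto simp: mem_argmax_on)
qed

section \<open>Positivity of the mean response time\<close>

lemma order_stat_mem:
  assumes "1 \<le> k" "k \<le> n"
  shows "order_stat n k x \<in> x ` {..<n}"
proof -
  have "k - 1 < length (sort (map x [0..<n]))"
    using assms by simp
  then have "order_stat n k x \<in> set (sort (map x [0..<n]))"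
    unfolding order_stat_def by (rule nth_mem)
  then show ?thesis
    by (auto simp: atLeast0LessThan)
qed

text \<open>The order statistic is one of finitely many almost surely positive response times and is
  integrable. The sign is needed to make the argument of the switching-time logarithm
  positive.\<close>

lemma mu_cur_pos:
  assumes "response_model P" "sgd_setting P"
  shows "0 < mu_cur P"
proof -
  interpret prob_space "M_resp P"
    using assms(1) by (simp add: response_model_def)
  have k: "1 \<le> k_cur P" "k_cur P \<le> n_workers P"
    using assms(2) by (auto simp: sgd_setting_def)
  obtain m where "1 \<le> m" "m \<le> n_samples P" "beta_cur P = real m / real (n_samples P)"
    using assms(2) unfolding sgd_setting_def by blast
  then have "beta_cur P \<in> {0<..1}"
    by simp
  then have scale: "beta_cur P \<in> scales P"
    using assms(1) by (auto simp: response_model_def)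
  let ?T = "\<lambda>\<omega>. order_stat (n_workers P) (k_cur P) (\<lambda>i. resp_time P (beta_cur P) i \<omega>)"
  have int: "integrable (M_resp P) ?T"
    using assms(1) scale by (simp add: response_model_def)
  have "AE \<omega> in M_resp P. \<forall>i\<in>{..<n_workers P}. 0 < resp_time P (beta_cur P) i \<omega>"
    using assms(1) scale by (intro AE_finite_allI) (auto simp: response_model_def)
  then have "AE \<omega> in M_resp P. 0 < ?T \<omega>"
  proof eventually_elim
    case (elim \<omega>)
    then show ?case
      using order_stat_mem[OF k, of "\<lambda>i. resp_time P (beta_cur P) i \<omega>"] by auto
  qed
  then have "0 < expectation ?T"
    by (rule expectation_greater[OF int])
  then show ?thesis
    by (simp add: mu_cur_def mean_time_def)
qed

section \<open>Closed form of the objective and its derivative\<close>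

lemma objective_eq:
  assumes "response_model P" "sgd_setting P" and dom: "\<beta> \<in> obj_domain P"
  shows "objective P \<beta> =
    alpha P * (lrate P * lip P * grad_var P)
      / (2 * cvx P * real (n_samples P) * phi_cur P * real (k_next P))
    * ((\<beta> * real (k_next P) - phi_cur P) / (\<beta> * (mu_next P \<beta> - mu_cur P)))"
proof -
  define A where "A = lrate P * lip P * grad_var P"
  define q where "q = 1 - lrate P * cvx P"
  define c where "c = cvx P"
  define s where "s = real (n_samples P)"
  define \<phi> where "\<phi> = phi_cur P"
  define \<phi>' where "\<phi>' = phi_next P \<beta>"
  define \<mu> where "\<mu> = mu_cur P"
  define \<mu>' where "\<mu>' = mu_next P \<beta>"
  define e where "e = err_start P"
  \<comment> \<open>The argument of the logarithm in \<open>t_switch\<close>; on the domain all its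
    factors are positive.\<close>
  define X where "X = (\<mu>' - \<mu>) * \<phi>' * (2 * c * \<phi> * s * e - A) / (\<mu> * A * (\<phi>' - \<phi>))"
  have pos: "0 < A" "0 < c" "0 < s" "0 < q" "q < 1" "0 < \<phi>" "A < 2 * c * \<phi> * s * e"
    using assms(2)
    by (auto simp: sgd_setting_def A_def q_def c_def s_def \<phi>_def e_def phi_cur_def)
  have mu: "0 < \<mu>" "\<mu> < \<mu>'" "\<phi> < \<phi>'"
    using mu_cur_pos[OF assms(1,2)] dom
    by (auto simp: \<mu>_def \<mu>'_def \<phi>_def \<phi>'_def obj_domain_def)
  have alpha: "alpha P = - ln q" "0 < - ln q"
    using pos by (simp_all add: alpha_def q_def)
  have "0 < X"
    unfolding X_def using pos mu by (intro divide_pos_pos mult_pos_pos) auto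
  have "(t_switch P \<beta> - t_start P) / mu_cur P = ln X / (- ln q)"
    using mu by (simp add: t_switch_def alpha X_def A_def c_def s_def \<phi>_def \<phi>'_def \<mu>_def \<mu>'_def e_def)
  \<comment> \<open>Since \<open>- ln q\<close> is \<open>alpha P\<close>, the decay factor over the
    whole stage is exactly \<open>1 / X\<close>.\<close>
  moreover have "q powr (ln X / (- ln q)) = 1 / X"
    using pos alpha(2) \<open>0 < X\<close> by (simp add: powr_def exp_minus inverse_eq_divide)
  moreover have "loss P (w_start P) - opt_loss P = e"
    by (simp add: e_def err_start_def)
  ultimately have err: "err_switch P \<beta> = A / (2 * c * \<phi> * s) + 1 / X * (e - A / (2 * c * \<phi> * s))"
    by (simp add: err_switch_def error_bound_def A_def c_def s_def \<phi>_def phi_cur_def q_def mult.assoc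
        mult.commute mult.left_commute)
  \<comment> \<open>The excess over the next error floor. The two floors differ by
    \<open>A * (\<phi>' - \<phi>) / (2 * c * s * \<phi> * \<phi>')\<close>, the decayed excess over
    the current floor adds \<open>\<mu> / (\<mu>' - \<mu>)\<close> times this, and
    \<open>1 + \<mu> / (\<mu>' - \<mu>) = \<mu>' / (\<mu>' - \<mu>)\<close>.\<close>
  have gap: "err_switch P \<beta> - A / (2 * c * s * \<phi>') =
      A * (\<phi>' - \<phi>) / (2 * c * s * \<phi> * \<phi>') * (\<mu>' / (\<mu>' - \<mu>))"
  proof -
    have "e - A / (2 * c * \<phi> * s) = (2 * c * \<phi> * s * e - A) / (2 * c * \<phi> * s)"
      using pos by (simp add: field_simps)
    moreover have "1 / X = \<mu> * A * (\<phi>' - \<phi>) / ((\<mu>' - \<mu>) * \<phi>' * (2 * c * \<phi> * s * e - A))"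
      by (simp add: X_def)
    \<comment> \<open>The starting error \<open>e\<close> drops out here: \<open>X\<close> carries
      the factor \<open>2 * c * \<phi> * s * e - A\<close>.\<close>
    ultimately have "1 / X * (e - A / (2 * c * \<phi> * s)) =
        \<mu> * A * (\<phi>' - \<phi>) / ((\<mu>' - \<mu>) * \<phi>' * (2 * c * \<phi> * s))"
      using pos by simp
    then have "err_switch P \<beta> = A / (2 * c * \<phi> * s)
        + \<mu> * A * (\<phi>' - \<phi>) / ((\<mu>' - \<mu>) * \<phi>' * (2 * c * \<phi> * s))"
      using err by simp
    moreover have "\<mu>' - \<mu> \<noteq> 0" "\<phi>' \<noteq> 0" "\<phi> \<noteq> 0" "c \<noteq> 0" "s \<noteq> 0"
      using pos mu by auto
    ultimately show ?thesis
      by (simp add: divide_simps) (simp add: algebra_simps)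
  qed
  have "((\<lambda>j. error_bound P (opt_loss P + err_switch P \<beta>) (k_next P) \<beta> j) has_real_derivative
      ln q * (err_switch P \<beta> - A / (2 * c * s * \<phi>'))) (at 0)"
    unfolding error_bound_def q_def[symmetric] using pos
    by (auto intro!: derivative_eq_intros
        simp: A_def c_def s_def \<phi>'_def phi_next_def mult.assoc mult.commute mult.left_commute)
  then have "objective P \<beta> = \<bar>ln q * (err_switch P \<beta> - A / (2 * c * s * \<phi>'))\<bar> / \<mu>'"
    by (simp add: objective_def DERIV_imp_deriv \<mu>'_def)
  also have "\<dots> = - ln q * (err_switch P \<beta> - A / (2 * c * s * \<phi>')) / \<mu>'"
  proof -
    have "0 < err_switch P \<beta> - A / (2 * c * s * \<phi>')"
      unfolding gap using pos mu by (intro mult_pos_pos divide_pos_pos) auto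
    then show ?thesis
      using alpha(2) by (simp add: abs_mult)
  qed
  \<comment> \<open>The factor \<open>\<mu>'\<close> of the gap cancels the division by the
    iteration time.\<close>
  also have "\<dots> = - ln q * A / (2 * c * s * \<phi> * real (k_next P)) * ((\<phi>' - \<phi>) / (\<beta> * (\<mu>' - \<mu>)))"
    unfolding gap using mu by (simp add: \<phi>'_def phi_next_def)
  finally show ?thesis
    by (simp add: alpha A_def c_def s_def \<phi>_def \<mu>_def \<mu>'_def \<phi>'_def phi_next_def mult.commute)
qed

text \<open>Both strict inequalities persist near a point where \<open>mu_next P\<close> is
  continuous. Openness serves to transfer the derivative from the closed form and to make maximisers
  interior.\<close>

lemma open_obj_domain:
  assumes "response_model P"
    and diff: "\<And>\<beta>. \<beta> \<in> obj_domain P \<Longrightarrow> mu_next P differentiable (at \<beta>)"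
  shows "open (obj_domain P)"
proof (subst open_subopen, intro ballI)
  fix \<beta> assume dom: "\<beta> \<in> obj_domain P"
  have "isCont (mu_next P) \<beta>"
    using diff[OF dom] by (rule differentiable_imp_continuous_within)
  then have "\<forall>\<^sub>F x in nhds \<beta>. mu_cur P < mu_next P x"
    using dom by (auto simp: obj_domain_def isCont_def tendsto_at_iff_tendsto_nhds intro: order_tendstoD)
  moreover have "\<forall>\<^sub>F x in nhds \<beta>. phi_cur P < phi_next P x"
    using dom unfolding phi_next_def obj_domain_def
    by (intro order_tendstoD(1)[of _ "real (k_next P) * \<beta>"] tendsto_intros filterlim_ident) auto
  moreover have "\<forall>\<^sub>F x in nhds \<beta>. x \<in> scales P"
    using assms(1) dom by (intro eventually_nhds_in_open) (auto simp: response_model_def obj_domain_def)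
  ultimately have "\<forall>\<^sub>F x in nhds \<beta>. x \<in> obj_domain P"
    by eventually_elim (simp add: obj_domain_def)
  then show "\<exists>T. open T \<and> \<beta> \<in> T \<and> T \<subseteq> obj_domain P"
    by (auto simp: eventually_nhds)
qed

text \<open>Only the zeros of the derivative matter later, so the factor \<open>C\<close>, which
  depends on \<open>\<beta>\<close>, is left abstract apart from being nonzero.\<close>

lemma objective_DERIV:
  assumes "response_model P" "sgd_setting P"
    and diff: "\<And>\<beta>. \<beta> \<in> obj_domain P \<Longrightarrow> mu_next P differentiable (at \<beta>)"
    and dom: "\<beta> \<in> obj_domain P"
  obtains C where "C \<noteq> 0"
    and "(objective P has_real_derivative
      C * (deriv (mu_next P) \<beta> * \<beta> * (\<beta> * real (k_next P) - phi_cur P)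
           + phi_cur P * (mu_cur P - mu_next P \<beta>))) (at \<beta>)"
proof -
  define K where "K = alpha P * (lrate P * lip P * grad_var P)
      / (2 * cvx P * real (n_samples P) * phi_cur P * real (k_next P))"
  have "0 < alpha P" "0 < phi_cur P"
    using assms(2) by (auto simp: sgd_setting_def alpha_def phi_cur_def)
  then have "0 < K"
    unfolding K_def using assms(2)
    by (intro mult_pos_pos divide_pos_pos) (auto simp: sgd_setting_def)
  have nz: "\<beta> \<noteq> 0" "mu_next P \<beta> - mu_cur P \<noteq> 0"
    using assms(1) dom by (auto simp: response_model_def obj_domain_def)
  have mu': "(mu_next P has_real_derivative deriv (mu_next P) \<beta>) (at \<beta>)"
    using diff[OF dom] by (simp add: DERIV_deriv_iff_real_differentiable)
  define D where "D = deriv (mu_next P) \<beta> * \<beta> * (\<beta> * real (k_next P) - phi_cur P)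
           + phi_cur P * (mu_cur P - mu_next P \<beta>)"
  have "((\<lambda>\<beta>. K * ((\<beta> * real (k_next P) - phi_cur P) / (\<beta> * (mu_next P \<beta> - mu_cur P))))
      has_real_derivative - K / (\<beta> * (mu_next P \<beta> - mu_cur P))\<^sup>2 * D) (at \<beta>)"
  proof -
    have "((\<lambda>\<beta>. \<beta> * real (k_next P) - phi_cur P) has_real_derivative real (k_next P)) (at \<beta>)"
      "((\<lambda>\<beta>. \<beta> * (mu_next P \<beta> - mu_cur P)) has_real_derivative
        mu_next P \<beta> - mu_cur P + \<beta> * deriv (mu_next P) \<beta>) (at \<beta>)"
      by (auto intro!: derivative_eq_intros mu')
    from DERIV_divide[OF this]
    have "((\<lambda>\<beta>. (\<beta> * real (k_next P) - phi_cur P) / (\<beta> * (mu_next P \<beta> - mu_cur P)))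
      has_real_derivative
      (real (k_next P) * (\<beta> * (mu_next P \<beta> - mu_cur P))
        - (\<beta> * real (k_next P) - phi_cur P) * (mu_next P \<beta> - mu_cur P + \<beta> * deriv (mu_next P) \<beta>))
      / (\<beta> * (mu_next P \<beta> - mu_cur P) * (\<beta> * (mu_next P \<beta> - mu_cur P)))) (at \<beta>)"
      using nz by simp
    \<comment> \<open>In the quotient-rule numerator the terms
      \<open>k_next P * \<beta> * (mu_next P \<beta> - mu_cur P)\<close> cancel.\<close>
    also have "real (k_next P) * (\<beta> * (mu_next P \<beta> - mu_cur P))
        - (\<beta> * real (k_next P) - phi_cur P) * (mu_next P \<beta> - mu_cur P + \<beta> * deriv (mu_next P) \<beta>) = - D"
      by (simp add: D_def algebra_simps)
    finally show ?thesis
      by (rule DERIV_cmult[THEN DERIV_cong]) (simp add: power2_eq_square)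
  qed
  \<comment> \<open>The closed form holds only on the domain, which is a neighbourhood of
    \<open>\<beta>\<close>.\<close>
  then have "(objective P has_real_derivative
      - K / (\<beta> * (mu_next P \<beta> - mu_cur P))\<^sup>2 * D) (at \<beta>)"
    by (rule has_field_derivative_transform_within_open[OF _ open_obj_domain[OF assms(1) diff] dom])
      (simp_all add: objective_eq[OF assms(1,2)] K_def)
  moreover have "- K / (\<beta> * (mu_next P \<beta> - mu_cur P))\<^sup>2 \<noteq> 0"
    using \<open>0 < K\<close> nz by simp
  ultimately show ?thesis
    using that unfolding D_def by blast
qed

section \<open>Rounding and clipping of batch scales\<close>

lemma mono_round_scale: "mono (round_scale P)"
  by (auto intro!: monoI divide_right_mono ceiling_mono mult_left_mono simp: round_scale_def)

text \<open>Both endpoints are multiples of \<open>1 / n_samples P\<close>, hence fixed by rounding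
  up. As \<open>k_cur P\<close> is at most \<open>k_next P\<close>, the ceiling in
  \<open>beta_min P\<close> is at most \<open>n_samples P\<close>.\<close>

lemma
  assumes "sgd_setting P"
  shows round_scale_beta_min: "round_scale P (beta_min P) = beta_min P"
    and round_scale_one: "round_scale P 1 = 1"
    and beta_min_le_one: "beta_min P \<le> 1"
proof -
  have s: "0 < real (n_samples P)" and k: "0 < real (k_next P)" "real (k_cur P) \<le> real (k_next P)"
    using assms by (auto simp: sgd_setting_def)
  show "round_scale P (beta_min P) = beta_min P" "round_scale P 1 = 1"
    using s by (simp_all add: round_scale_def beta_min_def)
  have "real (k_cur P) * real (n_samples P) / real (k_next P) \<le> real (n_samples P)"
    using s k by (simp add: field_simps)
  then have "\<lceil>real (k_cur P) * real (n_samples P) / real (k_next P)\<rceil> \<le> int (n_samples P)"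
    by (simp add: ceiling_le_iff)
  then show "beta_min P \<le> 1"
    using s unfolding beta_min_def by (simp add: divide_le_eq_1)
qed

theorem theorem3:
  fixes P :: "('a, 'w) sgd_stage"
  assumes response: "response_model P"
    and setting: "sgd_setting P"
    and diff: "\<And>\<beta>. \<beta> \<in> obj_domain P \<Longrightarrow> mu_next P differentiable (at \<beta>)"
    and feasible: "feasible_scales P \<noteq> {}"
    and concave: "concave_on (obj_domain P) (objective P)"
  shows "(argmax_on (objective P) (obj_domain P) \<noteq> {} \<longrightarrow>
           next_scales P =
             (\<lambda>b. max (beta_min P) (min 1 (round_scale P b)))
               ` argmax_on (objective P) (obj_domain P)) \<and>
         argmax_on (objective P) (obj_domain P) =
           argmax_on (objective P) (stationary_scales P)"
proof (intro conjI impI)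
  assume "argmax_on (objective P) (obj_domain P) \<noteq> {}"
  then have "next_scales P = round_scale P ` (\<lambda>b. max (beta_min P) (min 1 b))
      ` argmax_on (objective P) (obj_domain P)"
    using argmax_on_Icc_Int_concave[OF concave beta_min_le_one[OF setting]] feasible
    by (simp add: next_scales_def feasible_scales_def)
  \<comment> \<open>A monotone map commutes with \<open>max\<close> and \<open>min\<close>, and this
    one fixes both clipping bounds.\<close>
  moreover have "round_scale P (max (beta_min P) (min 1 b)) =
      max (beta_min P) (min 1 (round_scale P b))" for b
    using setting
    by (simp add: max_of_mono[OF mono_round_scale, symmetric] min_of_mono[OF mono_round_scale, symmetric]
        round_scale_beta_min round_scale_one)
  ultimately show "next_scales P =
      (\<lambda>b. max (beta_min P) (min 1 (round_scale P b))) ` argmax_on (objective P) (obj_domain P)"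
    by (simp add: image_image)
next
  have iff: "\<beta> \<in> argmax_on (objective P) (obj_domain P) \<longleftrightarrow> \<beta> \<in> stationary_scales P"
    if dom: "\<beta> \<in> obj_domain P" for \<beta>
  proof -
    obtain C where "C \<noteq> 0" and
      "(objective P has_real_derivative
        C * (deriv (mu_next P) \<beta> * \<beta> * (\<beta> * real (k_next P) - phi_cur P)
           + phi_cur P * (mu_cur P - mu_next P \<beta>))) (at \<beta>)"
      using objective_DERIV[OF response setting diff dom] by blast
    then show ?thesis
      using concave_on_argmax_iff_DERIV_zero[OF concave open_obj_domain[OF response diff] dom]
      by (simp add: stationary_scales_def dom)
  qed
  then have stationary: "\<beta> \<in> stationary_scales P \<longleftrightarrow> \<beta> \<in> argmax_on (objective P) (obj_domain P)" for \<beta>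
    by (auto simp: mem_argmax_on stationary_scales_def)
  \<comment> \<open>By concavity the stationary set already is the set of global maximisers, so
    maximising over it discards nothing; this also covers the case where both are empty.\<close>
  show "argmax_on (objective P) (obj_domain P) = argmax_on (objective P) (stationary_scales P)"
    unfolding set_eq_iff mem_argmax_on[of _ _ "stationary_scales P"] Ball_def stationary
    by (simp add: mem_argmax_on) blast
qed

end
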